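(* Let $1<\beta\le2$, $t\in\mathbb R$, and let $\lambda^{-1}\in\mathbb C$ be a zero of $1-\phi_t(z)$ with $\lambda_t^{-1}\le|\lambda^{-1}|<r_t^{-1}$. Define the function $g_\lambda$ by $$g_\lambda=\sum_{n=0}^\infty\frac{H_n(t,\underline1)}{\lambda^n}\chi_{[\underline0,\sigma^n(\underline1)]}.$$ Then $g_\lambda$ is a non-zero function in $\mathcal F$ satisfying $\mathcal L_tg_\lambda=\lambda g_\lambda$. In particular, $\lambda$ is an eigenvalue of $\mathcal L_t$.
   Context: For $1<\beta\le2$, $\tau_\beta(x)=\beta x-[\beta x]$ on $[0,1]$ and $g_n(x)=[\beta\tau_\beta^{n-1}(x)]$ are the greedy digits of $x$. $\{0,1\}^{\mathbb N}$ carries the product topology, the lexicographic order $\preceq$ and the left shift $\sigma$. $\underline0=000\cdots$ and $\underline1=(q_n(1))_{n\ge1}:=\lim_{y\nearrow1}(g_n(y))_{n\ge1}$ (quasi-greedy expansion of $1$). The beta-shift is $X_\beta=\{\underline x\in\{0,1\}^{\mathbb N}:\sigma^n(\underline x)\preceq\underline1\ \forall n\ge0\}$ with the map $\sigma$. For $\underline a,\underline b\in X_\beta$, $[\underline a,\underline b]=\{\underline x\in X_\beta:\underline a\preceq\underline x\preceq\underline b\}$; $\chi_A$ is the indicator function of $A$. Function spaces: for $f:X_\beta\to\mathbb C$, $\mathrm{var}(f)$ is the supremum of $\sum_{i=1}^n|f(x_i)-f(x_{i-1})|$ over finite chains $\underline0=x_0\prec x_1\prec\dots\prec x_n=\underline1$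 in $X_\beta$; $BV=\{f:\mathrm{var}(f)<\infty\}$ with norm $\|f\|_{BV}=|f|_\infty+\mathrm{var}(f)$, $|f|_\infty=\sup|f|$. $\mathcal N$ is the set of $f\in BV$ vanishing off a countable set, $\mathcal B=BV/\mathcal N$ with the quotient norm, and $\mathcal F\subset\mathcal B$ is the closure in $\mathcal B$ of the linear span of indicator functions of intervals in $X_\beta$. Operator: $C_1=\{(x_i)\in X_\beta:x_1=1\}$; $\mathcal L_tf(x)=\sum_{y:\sigma(y)=x}e^{t\chi_{C_1}(y)}f(y)$, a bounded operator on $\mathcal F$; $\mathcal L_t^*\nu=\nu\circ\mathcal L_t$ on the dual space $\mathcal F^*$. $\lambda_t>0$ and $\nu_t\in\mathcal F^*$ denote an eigenvalue and eigenfunctional with $\mathcal L_t^*\nu_t=\lambda_t\nu_t$, $\nu_t(f)\ge0$ for $f\ge0$, $\nu_t(1)=1$ (such a pair exists). $r_t=\limsup_{n\to\infty}|e^{tS_n\chi_{C_1}}|_\infty^{1/n}$ with $S_nf=\sum_{i=0}^{n-1}f\circ\sigma^i$. For $\underline x=(x_i)\in X_\beta$: $H_0(t,\underline x)=1$, $H_n(t,\underline x)=\exp(t\sum_{i=1}^nx_i)$ for $n\ge1$. $\phi_t(z)=\sum_{n=1}^\infty q_n(1)H_{n-1}(t,\underline1)z^n$, a power series with radius of convergence at least $r_t^{-1}$. *)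

theory Defs
  imports "HOL-Analysis.Analysis" "HOL-Library.Fun_Lexorder" "HOL-Library.Nonpos_Ints"
begin

section \<open>The beta-shift\<close>

text \<open>
  A sequence \<open>(x\<^sub>1, x\<^sub>2, \<dots>)\<close> is encoded as a function on \<^typ>\<open>nat\<close> starting at index 0, so that
  \<open>x\<^sub>i\<close> is \<open>x (i - 1)\<close>; likewise \<open>greedy_digit \<beta> n\<close> is the digit \<open>g\<^sub>n\<^sub>+\<^sub>1\<close> and
  \<open>qone \<beta> n\<close> is \<open>q\<^sub>n\<^sub>+\<^sub>1(1)\<close>.
\<close>

type_synonym symb = "nat \<Rightarrow> nat"

definition tau :: "real \<Rightarrow> real \<Rightarrow> real" where
  "tau \<beta> x = \<beta> * x - of_int \<lfloor>\<beta> * x\<rfloor>"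

definition greedy_digit :: "real \<Rightarrow> nat \<Rightarrow> real \<Rightarrow> nat" where
  "greedy_digit \<beta> n x = nat \<lfloor>\<beta> * (tau \<beta> ^^ n) x\<rfloor>"

text \<open>
  The limit is taken in the product topology on \<^typ>\<open>nat \<Rightarrow> nat\<close>, with discrete factors.
  It is spelled out with \<open>THE\<close> because \<open>Lim\<close> needs class \<open>t2_space\<close>, for which function types
  have no instance.
\<close>

definition qone :: "real \<Rightarrow> symb" where
  "qone \<beta> = (THE q. ((\<lambda>y n. greedy_digit \<beta> n y) \<longlongrightarrow> q) (at_left 1))"

definition zeroseq :: symb where
  "zeroseq = (\<lambda>_. 0)"

definition shift :: "symb \<Rightarrow> symb" where
  "shift x = (\<lambda>n. x (Suc n))"

definition lex_le :: "symb \<Rightarrow> symb \<Rightarrow> bool" where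
  "lex_le x y \<longleftrightarrow> less_fun x y \<or> x = y"

definition beta_shift :: "real \<Rightarrow> symb set" where
  "beta_shift \<beta> = {x. (\<forall>i. x i \<in> {0, 1}) \<and> (\<forall>n. lex_le ((shift ^^ n) x) (qone \<beta>))}"

definition interval :: "real \<Rightarrow> symb \<Rightarrow> symb \<Rightarrow> symb set" where
  "interval \<beta> a b = {x \<in> beta_shift \<beta>. lex_le a x \<and> lex_le x b}"

definition cyl1 :: "real \<Rightarrow> symb set" where
  "cyl1 \<beta> = {x \<in> beta_shift \<beta>. x 0 = 1}"

section \<open>Functions of bounded variation\<close>

text \<open>
  Functions on the beta-shift are total functions on \<^typ>\<open>nat \<Rightarrow> nat\<close> whose values outside
  \<open>beta_shift \<beta>\<close> are never used; in the quotient below they are identified.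
\<close>

type_synonym cfun = "symb \<Rightarrow> complex"

definition chain :: "real \<Rightarrow> nat \<Rightarrow> (nat \<Rightarrow> symb) \<Rightarrow> bool" where
  "chain \<beta> n x \<longleftrightarrow> x 0 = zeroseq \<and> x n = qone \<beta> \<and>
     (\<forall>i\<le>n. x i \<in> beta_shift \<beta>) \<and> (\<forall>i<n. less_fun (x i) (x (Suc i)))"

definition var :: "real \<Rightarrow> cfun \<Rightarrow> ereal" where
  "var \<beta> f = (SUP (n, x) \<in> {(n, x). chain \<beta> n x}.
     ereal (\<Sum>i=1..n. norm (f (x i) - f (x (i - 1)))))"

definition BV :: "real \<Rightarrow> cfun set" where
  "BV \<beta> = {f. var \<beta> f < \<infinity>}"

definition sup_norm :: "real \<Rightarrow> (symb \<Rightarrow> 'a::real_normed_vector) \<Rightarrow> real" where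
  "sup_norm \<beta> f = (SUP x \<in> beta_shift \<beta>. norm (f x))"

text \<open>To be used for \<open>f \<in> BV \<beta>\<close> only, where both summands are finite.\<close>

definition BV_norm :: "real \<Rightarrow> cfun \<Rightarrow> real" where
  "BV_norm \<beta> f = sup_norm \<beta> f + real_of_ereal (var \<beta> f)"

definition null_BV :: "real \<Rightarrow> cfun set" where
  "null_BV \<beta> = {f \<in> BV \<beta>. countable {x \<in> beta_shift \<beta>. f x \<noteq> 0}}"

section \<open>The quotient space and the closed span of the intervals\<close>

definition BV_rel :: "real \<Rightarrow> (cfun \<times> cfun) set" where
  "BV_rel \<beta> = {(f, g). f \<in> BV \<beta> \<and> g \<in> BV \<beta> \<and> (\<lambda>x. f x - g x) \<in> null_BV \<beta>}"

definition cls :: "real \<Rightarrow> cfun \<Rightarrow> cfun set" where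
  "cls \<beta> f = BV_rel \<beta> `` {f}"

definition Bspace :: "real \<Rightarrow> cfun set set" where
  "Bspace \<beta> = BV \<beta> // BV_rel \<beta>"

definition cls_add :: "real \<Rightarrow> cfun set \<Rightarrow> cfun set \<Rightarrow> cfun set" where
  "cls_add \<beta> u v = (\<Union>f\<in>u. \<Union>g\<in>v. cls \<beta> (\<lambda>x. f x + g x))"

definition cls_scale :: "real \<Rightarrow> complex \<Rightarrow> cfun set \<Rightarrow> cfun set" where
  "cls_scale \<beta> c u = (\<Union>f\<in>u. cls \<beta> (\<lambda>x. c * f x))"

definition cls_zero :: "real \<Rightarrow> cfun set" where
  "cls_zero \<beta> = cls \<beta> (\<lambda>_. 0)"

definition quot_norm :: "real \<Rightarrow> cfun set \<Rightarrow> real" where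
  "quot_norm \<beta> u = (INF f \<in> u. BV_norm \<beta> f)"

definition interval_span :: "real \<Rightarrow> cfun set" where
  "interval_span \<beta> = {s. \<exists>(n::nat) c a b.
     (\<forall>i<n. a i \<in> beta_shift \<beta> \<and> b i \<in> beta_shift \<beta>) \<and>
     s = (\<lambda>x. \<Sum>i<n. c i * indicator (interval \<beta> (a i) (b i)) x)}"

definition Fspace :: "real \<Rightarrow> cfun set set" where
  "Fspace \<beta> = {u \<in> Bspace \<beta>. \<forall>\<epsilon>>0. \<exists>s \<in> interval_span \<beta>.
     quot_norm \<beta> (cls_add \<beta> u (cls_scale \<beta> (-1) (cls \<beta> s))) < \<epsilon>}"

definition cls_nonneg :: "real \<Rightarrow> cfun set \<Rightarrow> bool" where
  "cls_nonneg \<beta> u \<longleftrightarrow> (\<exists>f\<in>u. \<forall>x\<in>beta_shift \<beta>. f x \<in> \<real>\<^sub>\<ge>\<^sub>0)"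

definition dual_F :: "real \<Rightarrow> (cfun set \<Rightarrow> complex) set" where
  "dual_F \<beta> = {\<nu>.
     (\<forall>u\<in>Fspace \<beta>. \<forall>v\<in>Fspace \<beta>. \<nu> (cls_add \<beta> u v) = \<nu> u + \<nu> v) \<and>
     (\<forall>c. \<forall>u\<in>Fspace \<beta>. \<nu> (cls_scale \<beta> c u) = c * \<nu> u) \<and>
     (\<exists>K. \<forall>u\<in>Fspace \<beta>. norm (\<nu> u) \<le> K * quot_norm \<beta> u)}"

section \<open>The transfer operator\<close>

definition transfer_fun :: "real \<Rightarrow> real \<Rightarrow> cfun \<Rightarrow> cfun" where
  "transfer_fun \<beta> t f x =
     (\<Sum>y \<in> {y \<in> beta_shift \<beta>. shift y = x}. of_real (exp (t * indicator (cyl1 \<beta>) y)) * f y)"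

text \<open>The operator induced on classes of functions.\<close>

definition transfer_op :: "real \<Rightarrow> real \<Rightarrow> cfun set \<Rightarrow> cfun set" where
  "transfer_op \<beta> t u = (\<Union>f\<in>u. cls \<beta> (transfer_fun \<beta> t f))"

definition is_eigenvalue :: "real \<Rightarrow> real \<Rightarrow> complex \<Rightarrow> bool" where
  "is_eigenvalue \<beta> t \<mu> \<longleftrightarrow>
     (\<exists>u\<in>Fspace \<beta>. u \<noteq> cls_zero \<beta> \<and> transfer_op \<beta> t u = cls_scale \<beta> \<mu> u)"

definition dual_eigenpair :: "real \<Rightarrow> real \<Rightarrow> real \<Rightarrow> (cfun set \<Rightarrow> complex) \<Rightarrow> bool" where
  "dual_eigenpair \<beta> t lt \<nu> \<longleftrightarrow> lt > 0 \<and> \<nu> \<in> dual_F \<beta> \<and>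
     (\<forall>u\<in>Fspace \<beta>. \<nu> (transfer_op \<beta> t u) = of_real lt * \<nu> u) \<and>
     (\<forall>u\<in>Fspace \<beta>. cls_nonneg \<beta> u \<longrightarrow> \<nu> u \<in> \<real>\<^sub>\<ge>\<^sub>0) \<and>
     \<nu> (cls \<beta> (\<lambda>_. 1)) = 1"

definition birkhoff :: "(symb \<Rightarrow> real) \<Rightarrow> nat \<Rightarrow> symb \<Rightarrow> real" where
  "birkhoff f n x = (\<Sum>i<n. f ((shift ^^ i) x))"

definition growth_rate :: "real \<Rightarrow> real \<Rightarrow> ereal" where
  "growth_rate \<beta> t =
     limsup (\<lambda>n. ereal (root n (sup_norm \<beta> (\<lambda>x. exp (t * birkhoff (indicator (cyl1 \<beta>)) n x)))))"

definition H :: "nat \<Rightarrow> real \<Rightarrow> symb \<Rightarrow> real" where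
  "H n t x = exp (t * (\<Sum>i<n. real (x i)))"

text \<open>The summand at index \<open>n\<close> is the term of degree \<open>n + 1\<close> of the power series.\<close>

definition phi :: "real \<Rightarrow> real \<Rightarrow> complex \<Rightarrow> complex" where
  "phi \<beta> t z = (\<Sum>n. of_nat (qone \<beta> n) * of_real (H n t (qone \<beta>)) * z ^ Suc n)"

definition g_term :: "real \<Rightarrow> real \<Rightarrow> complex \<Rightarrow> nat \<Rightarrow> cfun" where
  "g_term \<beta> t lam n x = of_real (H n t (qone \<beta>)) / lam ^ n *
     indicator (interval \<beta> zeroseq ((shift ^^ n) (qone \<beta>))) x"

definition g_fun :: "real \<Rightarrow> real \<Rightarrow> complex \<Rightarrow> cfun" where
  "g_fun \<beta> t lam x = (\<Sum>n. g_term \<beta> t lam n x)"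

end

theory Submission
  imports Defs
begin

text \<open>
  Write \<open>q\<close> for the quasi-greedy expansion of 1. On the beta-shift, the transfer operator maps the
  indicator of \<open>[0, b]\<close> to \<open>b\<^sub>1 + exp (t b\<^sub>1) \<chi>\<^bsub>[0, \<sigma> b]\<^esub>\<close>. Applied to the series \<open>g\<close> this shifts the
  index and produces the extra constant \<open>\<lambda> \<phi>(1/\<lambda>) = \<lambda>\<close>, which restores the missing term of index
  0. The root test makes the coefficients absolutely summable, so the series converges in the
  bounded variation norm. The function \<open>g\<close> is not in the null space: along the greedy expansions of \<open>y\<close> with
  \<open>y \<nearrow> 1\<close>, which are pairwise distinct, it tends to the sum \<open>S\<close> of its coefficients over those \<open>n\<close>
  with \<open>\<sigma>\<^sup>n q = q\<close>, and \<open>S \<noteq> 0\<close>.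
\<close>

section \<open>The lexicographic order\<close>

lemma less_fun_linear:
  fixes x y :: "nat \<Rightarrow> 'b::linorder"
  shows "less_fun x y \<or> x = y \<or> less_fun y x"
proof (cases "x = y")
  case False
  then obtain k where "x k \<noteq> y k" by blast
  define m where "m = (LEAST k. x k \<noteq> y k)"
  have "x m \<noteq> y m" unfolding m_def using \<open>x k \<noteq> y k\<close> by (rule LeastI)
  moreover have "\<forall>j<m. x j = y j" unfolding m_def using not_less_Least by blast
  ultimately show ?thesis unfolding less_fun_def by (metis linorder_neqE)
qed simp

lemma lex_le_refl [simp]: "lex_le x x"
  by (simp add: lex_le_def)

lemma lex_le_trans: "lex_le x y \<Longrightarrow> lex_le y z \<Longrightarrow> lex_le x z"
  unfolding lex_le_def using less_fun_trans by blast

lemma lex_le_antisym: "lex_le x y \<Longrightarrow> lex_le y x \<Longrightarrow> x = y"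
  unfolding lex_le_def using less_fun_asym by blast

lemma not_lex_le: "\<not> lex_le x y \<longleftrightarrow> less_fun y x"
  unfolding lex_le_def using less_fun_linear less_fun_asym less_fun_irrefl by blast

lemma zeroseq_lex_le [simp]: "lex_le zeroseq x"
  by (metis not_lex_le less_fun_def not_less_zero zeroseq_def)

lemma less_fun_unfold:
  fixes x y :: symb
  shows "less_fun x y \<longleftrightarrow> x 0 < y 0 \<or> x 0 = y 0 \<and> less_fun (shift x) (shift y)"
proof
  assume "less_fun x y"
  then obtain k where k: "x k < y k" "\<And>j. j < k \<Longrightarrow> x j = y j"
    unfolding less_fun_def by blast
  show "x 0 < y 0 \<or> x 0 = y 0 \<and> less_fun (shift x) (shift y)"
  proof (cases k)
    case (Suc m)
    then have "less_fun (shift x) (shift y)"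
      using k by (auto simp: less_fun_def shift_def intro!: exI[of _ m])
    then show ?thesis using k Suc by simp
  qed (use k in simp)
next
  assume "x 0 < y 0 \<or> x 0 = y 0 \<and> less_fun (shift x) (shift y)"
  then show "less_fun x y"
  proof (elim disjE conjE)
    assume eq: "x 0 = y 0" and "less_fun (shift x) (shift y)"
    then obtain m where "x (Suc m) < y (Suc m)" "\<forall>j<m. x (Suc j) = y (Suc j)"
      unfolding less_fun_def shift_def by blast
    then show ?thesis
      using eq unfolding less_fun_def by (metis less_Suc_eq_0_disj)
  qed (auto simp: less_fun_def)
qed

lemma shift_eqI: "x 0 = y 0 \<Longrightarrow> shift x = shift y \<Longrightarrow> x = y"
  by (metis ext not0_implies_Suc shift_def)

text \<open>Head-and-tail recursion for the order. It reduces comparisons involving a preimage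
  \<open>case_nat a x\<close> under \<open>shift\<close> to comparisons of \<open>x\<close>
  itself.\<close>

lemma lex_le_unfold:
  "lex_le x y \<longleftrightarrow> x 0 < y 0 \<or> x 0 = y 0 \<and> lex_le (shift x) (shift y)"
  unfolding lex_le_def using less_fun_unfold[of x y] shift_eqI[of x y] by metis

lemma shift_case_nat [simp]: "shift (case_nat a x) = x"
  by (simp add: shift_def)

lemma case_nat_shift [simp]: "case_nat (x 0) (shift x) = x"
  by (rule shift_eqI) simp_all

lemma shift_funpow: "(shift ^^ n) x k = x (k + n)"
  by (induction n arbitrary: k) (simp_all add: shift_def)

section \<open>Convergence of sequences in the product topology\<close>

lemma tendsto_symb_iff:
  fixes l :: symb
  shows "(f \<longlongrightarrow> l) F \<longleftrightarrow> (\<forall>n. \<forall>\<^sub>F y in F. f y n = l n)"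
proof -
  have "(f \<longlongrightarrow> l) F \<longleftrightarrow> (\<forall>n. ((\<lambda>y. f y n) \<longlongrightarrow> l n) F)"
    using limitin_componentwise[of "\<lambda>_::nat. euclidean :: nat topology" UNIV f l F]
    by (simp add: euclidean_product_topology)
  \<comment> \<open>The factors are discrete, so convergence of a coordinate means that it is
    eventually equal to its limit.\<close>
  then show ?thesis by (simp add: tendsto_discrete)
qed

lemma tendsto_shift_funpow:
  "(f \<longlongrightarrow> l) F \<Longrightarrow> ((\<lambda>y. (shift ^^ n) (f y)) \<longlongrightarrow> (shift ^^ n) l) F"
  by (simp add: tendsto_symb_iff shift_funpow)

text \<open>A strict comparison is decided by the coordinates up to the first difference. These are
  finitely many, so they eventually agree with those of the limits.\<close>

lemma eventually_less_fun:
  fixes x z :: symb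
  assumes "(f \<longlongrightarrow> x) F" and "(g \<longlongrightarrow> z) F" and "less_fun x z"
  shows "\<forall>\<^sub>F y in F. less_fun (f y) (g y)"
proof -
  obtain k where k: "x k < z k" "\<And>j. j < k \<Longrightarrow> x j = z j"
    using assms(3) unfolding less_fun_def by blast
  have "\<forall>\<^sub>F y in F. \<forall>j\<in>{..k}. f y j = x j \<and> g y j = z j"
    using assms(1,2) by (intro eventually_ball_finite) (auto simp: tendsto_symb_iff eventually_conj)
  then show ?thesis
  proof eventually_elim
    case (elim y)
    then show ?case using k unfolding less_fun_def
      by (intro exI[of _ k]) auto
  qed
qed

text \<open>The strict order is open by \<open>eventually_less_fun\<close>, hence its negation, the
  reversed weak order, passes to limits.\<close>

lemma lex_le_tendsto:
  fixes x z :: symb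
  assumes "(f \<longlongrightarrow> x) F" and "(g \<longlongrightarrow> z) F" and "F \<noteq> bot"
    and "\<forall>\<^sub>F y in F. lex_le (f y) (g y)"
  shows "lex_le x z"
proof (rule ccontr)
  assume "\<not> lex_le x z"
  then have "\<forall>\<^sub>F y in F. less_fun (g y) (f y)"
    using assms(1,2) by (intro eventually_less_fun) (auto simp: not_lex_le)
  with assms(4) have "\<forall>\<^sub>F y in F. False"
    by eventually_elim (simp flip: not_lex_le)
  then show False using assms(3) by simp
qed

section \<open>Greedy and quasi-greedy expansions\<close>

locale beta_numeration =
  fixes \<beta> :: real
  assumes gt1: "1 < \<beta>" and le2: "\<beta> \<le> 2"
begin

abbreviation digits :: "real \<Rightarrow> symb" where
  "digits y \<equiv> \<lambda>n. greedy_digit \<beta> n y"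

lemma tau_range: "0 \<le> tau \<beta> x" "tau \<beta> x < 1"
  unfolding tau_def by linarith+

lemma tau_funpow_range:
  assumes "0 \<le> y" "y < 1"
  shows "0 \<le> (tau \<beta> ^^ n) y" "(tau \<beta> ^^ n) y < 1"
  using assms by (cases n; simp add: tau_range)+

lemma floor_digit:
  assumes "0 \<le> y" "y < 1"
  shows "\<lfloor>\<beta> * (tau \<beta> ^^ n) y\<rfloor> = int (greedy_digit \<beta> n y)" "greedy_digit \<beta> n y \<in> {0, 1}"
proof -
  let ?v = "(tau \<beta> ^^ n) y"
  have "0 \<le> \<beta> * ?v" using tau_funpow_range[OF assms] gt1 by simp
  moreover have "\<beta> * ?v < \<beta>" using tau_funpow_range[OF assms, of n] gt1 by simp
  then have "\<beta> * ?v < 2" using le2 by linarith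
  ultimately have "0 \<le> \<lfloor>\<beta> * ?v\<rfloor>" "\<lfloor>\<beta> * ?v\<rfloor> < 2" by linarith+
  then have "nat \<lfloor>\<beta> * ?v\<rfloor> = 0 \<or> nat \<lfloor>\<beta> * ?v\<rfloor> = 1" "\<lfloor>\<beta> * ?v\<rfloor> = int (nat \<lfloor>\<beta> * ?v\<rfloor>)"
    by presburger+
  then show "\<lfloor>\<beta> * ?v\<rfloor> = int (greedy_digit \<beta> n y)" "greedy_digit \<beta> n y \<in> {0, 1}"
    unfolding greedy_digit_def by blast+
qed

lemma shift_digits: "(shift ^^ n) (digits y) = digits ((tau \<beta> ^^ n) y)"
  by (rule ext) (simp add: shift_funpow greedy_digit_def funpow_add)

text \<open>While the digits agree, each step multiplies the distance of the two orbits by \<beta>.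
  Orbits stay in the unit interval, so the digits must differ somewhere. At the first difference the
  orbit of \<open>z\<close> is still above that of \<open>y\<close>, and monotonicity of the floor
  orders the digits.\<close>

lemma digits_strict_mono:
  assumes "0 \<le> y" "y < z" "z < 1"
  shows "less_fun (digits y) (digits z)"
proof -
  have y: "0 \<le> y" "y < 1" and z: "0 \<le> z" "z < 1" using assms by auto
  have diff: "(tau \<beta> ^^ n) z - (tau \<beta> ^^ n) y = \<beta> ^ n * (z - y)"
    if "\<forall>k<n. digits y k = digits z k" for n
    using that
  proof (induction n)
    case (Suc n)
    have "(tau \<beta> ^^ Suc n) z - (tau \<beta> ^^ Suc n) y = \<beta> * ((tau \<beta> ^^ n) z - (tau \<beta> ^^ n) y)"
      using Suc.prems floor_digit(1)[OF y, of n] floor_digit(1)[OF z, of n]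
      by (simp add: tau_def algebra_simps)
    then show ?case using Suc by simp
  qed simp
  have "digits y \<noteq> digits z"
  proof
    assume eq: "digits y = digits z"
    obtain n where "1 / (z - y) < \<beta> ^ n" using gt1 real_arch_pow by blast
    then have "1 < \<beta> ^ n * (z - y)" using assms by (simp add: field_simps)
    moreover have "(tau \<beta> ^^ n) z - (tau \<beta> ^^ n) y = \<beta> ^ n * (z - y)"
      using eq by (intro diff) (simp add: fun_eq_iff)
    ultimately show False
      using tau_funpow_range[OF y, of n] tau_funpow_range[OF z, of n] by linarith
  qed
  moreover have "\<not> less_fun (digits z) (digits y)"
  proof
    assume "less_fun (digits z) (digits y)"
    then obtain k where k: "digits z k < digits y k" "\<forall>j<k. digits z j = digits y j"
      unfolding less_fun_def by blast
    have "(tau \<beta> ^^ k) z - (tau \<beta> ^^ k) y = \<beta> ^ k * (z - y)" using k by (intro diff) auto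
    then have "(tau \<beta> ^^ k) y \<le> (tau \<beta> ^^ k) z" using assms gt1 by (smt (verit) mult_nonneg_nonneg zero_le_power)
    then have "\<lfloor>\<beta> * (tau \<beta> ^^ k) y\<rfloor> \<le> \<lfloor>\<beta> * (tau \<beta> ^^ k) z\<rfloor>"
      using gt1 by (intro floor_mono) simp
    then show False using k(1) floor_digit(1)[OF y, of k] floor_digit(1)[OF z, of k] by simp
  qed
  ultimately show ?thesis using less_fun_linear by blast
qed

section \<open>Left limits of orbits and digits\<close>

lemma tau_at_left:
  obtains k :: int where "filterlim (tau \<beta>) (at_left (\<beta> * L - k)) (at_left L)"
    and "\<forall>\<^sub>F v in at_left L. \<lfloor>\<beta> * v\<rfloor> = k"
proof
  \<comment> \<open>This is the floor of \<beta>v for \<open>v\<close> just to the left of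
    \<open>L\<close>. It differs from the floor at \<open>L\<close> itself exactly when \<beta>L is
    an integer.\<close>
  define k where "k = \<lceil>\<beta> * L\<rceil> - 1"
  have k: "k < \<beta> * L" "\<beta> * L \<le> k + 1" unfolding k_def by linarith+
  have ev: "\<forall>\<^sub>F v in at_left L. k / \<beta> < v \<and> v < L"
    using k gt1 by (intro eventually_at_leftI[of "k / \<beta>"]) (auto simp: field_simps)
  then show fl: "\<forall>\<^sub>F v in at_left L. \<lfloor>\<beta> * v\<rfloor> = k"
  proof eventually_elim
    case (elim v)
    then have "k < \<beta> * v" "\<beta> * v < \<beta> * L" using gt1 by (auto simp: field_simps)
    then show ?case using k by linarith
  qed
  have tau: "\<forall>\<^sub>F v in at_left L. \<beta> * v - k = tau \<beta> v"
    using fl by eventually_elim (simp add: tau_def)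
  have "((\<lambda>v. \<beta> * v - k) \<longlongrightarrow> \<beta> * L - k) (at_left L)"
    by (intro tendsto_intros)
  then have "(tau \<beta> \<longlongrightarrow> \<beta> * L - k) (at_left L)"
    using tau by (rule Lim_transform_eventually)
  moreover have "\<forall>\<^sub>F v in at_left L. tau \<beta> v \<in> {..<\<beta> * L - k} \<and> tau \<beta> v \<noteq> \<beta> * L - k"
    using ev tau
  proof eventually_elim
    case (elim v)
    then have "\<beta> * v < \<beta> * L" using gt1 by simp
    then show ?case using elim by simp
  qed
  ultimately show "filterlim (tau \<beta>) (at_left (\<beta> * L - k)) (at_left L)"
    by (simp add: filterlim_at)
qed

text \<open>Just to the left of any point \<open>tau \<beta>\<close> is affine with positive slope,
  so approach from the left is preserved by every iterate.\<close>

lemma tau_funpow_at_left: "\<exists>L. filterlim (tau \<beta> ^^ n) (at_left L) (at_left 1)"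
proof (induction n)
  case 0
  show ?case by (intro exI[of _ 1]) (simp add: filterlim_ident id_def)
next
  case (Suc n)
  then obtain L where "filterlim (tau \<beta> ^^ n) (at_left L) (at_left 1)" by blast
  then show ?case
    using tau_at_left[of L] filterlim_compose unfolding funpow.simps comp_def by metis
qed

text \<open>As \<open>y\<close> tends to 1 from the left, the orbit point that determines a given
  digit approaches its limit from the left, where the floor is locally constant.\<close>

lemma digits_convergent: "\<exists>l. (digits \<longlongrightarrow> l) (at_left 1)"
proof -
  have "\<exists>m. \<forall>\<^sub>F y in at_left 1. greedy_digit \<beta> n y = m" for n
  proof -
    obtain L where L: "filterlim (tau \<beta> ^^ n) (at_left L) (at_left 1)"
      using tau_funpow_at_left by blast
    obtain k :: int where "\<forall>\<^sub>F v in at_left L. \<lfloor>\<beta> * v\<rfloor> = k" using tau_at_left by blast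
    then have "\<forall>\<^sub>F y in at_left 1. \<lfloor>\<beta> * (tau \<beta> ^^ n) y\<rfloor> = k"
      using L unfolding filterlim_iff by blast
    then show ?thesis unfolding greedy_digit_def by (intro exI[of _ "nat k"]) (auto elim!: eventually_mono)
  qed
  then obtain l where "\<And>n. \<forall>\<^sub>F y in at_left 1. greedy_digit \<beta> n y = l n" by metis
  then show ?thesis by (auto simp: tendsto_symb_iff)
qed

lemma digits_tendsto_qone: "(digits \<longlongrightarrow> qone \<beta>) (at_left 1)"
proof -
  \<comment> \<open>Uniqueness of the limit, as required by \<open>THE\<close>: closedness of the
    order puts each limit below the other.\<close>
  have "l = l'" if "(digits \<longlongrightarrow> l) (at_left 1)" "(digits \<longlongrightarrow> l') (at_left 1)" for l l'
    using that by (intro lex_le_antisym lex_le_tendsto[where F = "at_left (1::real)"]) auto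
  then have "\<exists>!l. (digits \<longlongrightarrow> l) (at_left 1)" using digits_convergent by blast
  then show ?thesis unfolding qone_def by (rule theI')
qed

lemma eventually_unit_interval: "\<forall>\<^sub>F y in at_left 1. 0 < y \<and> y < (1::real)"
  by (intro eventually_at_leftI[of 0]) auto

text \<open>By monotonicity \<open>digits y\<close> lies below \<open>digits z\<close> for all
  \<open>z\<close> between \<open>y\<close> and 1; now let \<open>z\<close> tend to 1.\<close>

lemma digits_le_qone:
  assumes "0 \<le> y" "y < 1"
  shows "lex_le (digits y) (qone \<beta>)"
proof (rule lex_le_tendsto[OF tendsto_const digits_tendsto_qone])
  have "\<forall>\<^sub>F z in at_left (1::real). y < z \<and> z < 1"
    using assms by (intro eventually_at_leftI[of y]) auto
  then show "\<forall>\<^sub>F z in at_left 1. lex_le (digits y) (digits z)"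
    by eventually_elim (use assms digits_strict_mono in \<open>auto simp: lex_le_def\<close>)
qed simp

lemma digits_in_beta_shift:
  assumes "0 \<le> y" "y < 1"
  shows "digits y \<in> beta_shift \<beta>"
  using assms floor_digit(2)[OF assms] tau_funpow_range[OF assms]
  by (simp add: beta_shift_def shift_digits digits_le_qone)

lemma qone_in_beta_shift: "qone \<beta> \<in> beta_shift \<beta>"
proof -
  have "qone \<beta> i \<in> {0, 1}" for i
  proof -
    have "\<forall>\<^sub>F y in at_left 1. digits y i = qone \<beta> i"
      using digits_tendsto_qone unfolding tendsto_symb_iff by blast
    with eventually_unit_interval have "\<forall>\<^sub>F y in at_left (1::real). qone \<beta> i \<in> {0, 1}"
      by eventually_elim (metis floor_digit(2) less_imp_le)
    then show ?thesis by simp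
  qed
  \<comment> \<open>Shifted greedy digits of \<open>y\<close> are the greedy digits of an orbit
    point, hence bounded by \<open>qone \<beta>\<close>; the bound survives the limit.\<close>
  moreover have "lex_le ((shift ^^ n) (qone \<beta>)) (qone \<beta>)" for n
  proof (rule lex_le_tendsto[OF tendsto_shift_funpow[OF digits_tendsto_qone] tendsto_const])
    show "\<forall>\<^sub>F y in at_left 1. lex_le ((shift ^^ n) (digits y)) (qone \<beta>)"
      using eventually_unit_interval
      by eventually_elim (auto simp: shift_digits intro!: digits_le_qone tau_funpow_range)
  qed simp
  ultimately show ?thesis unfolding beta_shift_def by blast
qed

lemma qone_0: "qone \<beta> 0 = 1"
proof -
  have "\<forall>\<^sub>F y in at_left 1. digits y 0 = qone \<beta> 0"
    using digits_tendsto_qone unfolding tendsto_symb_iff by blast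
  moreover have "\<forall>\<^sub>F y in at_left 1. inverse \<beta> < y \<and> y < (1::real)"
    using gt1 by (intro eventually_at_leftI[of "inverse \<beta>"]) (auto simp: field_simps)
  ultimately have "\<forall>\<^sub>F y in at_left (1::real). qone \<beta> 0 = 1"
  proof eventually_elim
    case (elim y)
    then have "1 < \<beta> * y" "\<beta> * y < 2" using gt1 le2 
      by (auto simp: field_simps intro: order.strict_trans2[of _ \<beta>])
    then have "\<lfloor>\<beta> * y\<rfloor> = 1" by linarith
    then show ?case using elim by (simp add: greedy_digit_def)
  qed
  then show ?thesis by simp
qed

end

section \<open>Bounded variation\<close>

context beta_numeration
begin

abbreviation X :: "symb set" where "X \<equiv> beta_shift \<beta>"

text \<open>Splitting off the instance for index 0 of both defining conditions gives a recursive
  membership test, which also contains shift invariance.\<close>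

lemma beta_shift_unfold: "x \<in> X \<longleftrightarrow> x 0 \<in> {0, 1} \<and> lex_le x (qone \<beta>) \<and> shift x \<in> X"
proof -
  have all_nat: "(\<forall>n::nat. P n) \<longleftrightarrow> P 0 \<and> (\<forall>n. P (Suc n))" for P
    by (metis not0_implies_Suc)
  have "(\<forall>i. x i \<in> {0, 1}) \<longleftrightarrow> x 0 \<in> {0, 1} \<and> (\<forall>i. shift x i \<in> {0, 1})"
    unfolding shift_def by (rule all_nat)
  moreover have "(\<forall>n. lex_le ((shift ^^ n) x) (qone \<beta>)) \<longleftrightarrow>
    lex_le x (qone \<beta>) \<and> (\<forall>n. lex_le ((shift ^^ n) (shift x)) (qone \<beta>))"
    by (subst all_nat) (simp add: funpow_swap1)
  ultimately show ?thesis unfolding beta_shift_def by blast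
qed

lemma shift_funpow_in_beta_shift:
  assumes "x \<in> X"
  shows "(shift ^^ n) x \<in> X"
proof (induction n)
  case (Suc n)
  then show ?case using beta_shift_unfold[of "(shift ^^ n) x"] by simp
qed (use assms in simp)

lemma lex_le_qone: "x \<in> X \<Longrightarrow> lex_le x (qone \<beta>)"
  using beta_shift_unfold by blast

lemma zeroseq_in_beta_shift: "zeroseq \<in> X"
proof -
  have "(shift ^^ n) zeroseq = zeroseq" for n
    by (rule ext) (simp add: shift_funpow, simp add: zeroseq_def)
  then show ?thesis by (simp add: beta_shift_def) (simp add: zeroseq_def)
qed

lemma zeroseq_less_qone: "less_fun zeroseq (qone \<beta>)"
  using qone_0 by (auto simp: less_fun_def zeroseq_def intro!: exI[of _ 0])

section \<open>Variation along weakly increasing chains\<close>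

definition lex_mono :: "nat \<Rightarrow> (nat \<Rightarrow> symb) \<Rightarrow> bool" where
  "lex_mono n y \<longleftrightarrow> (\<forall>i\<le>n. y i \<in> X) \<and> (\<forall>i<n. lex_le (y i) (y (Suc i)))"

text \<open>
  Unlike \<^const>\<open>var\<close>, \<open>var_le\<close> uses weakly increasing chains with arbitrary end points, because
  these are preserved by monotone maps.
\<close>

definition var_le :: "cfun \<Rightarrow> real \<Rightarrow> bool" where
  "var_le f B \<longleftrightarrow> (\<forall>n y. lex_mono n y \<longrightarrow> (\<Sum>i<n. norm (f (y (Suc i)) - f (y i))) \<le> B)"

lemma lex_mono_strictify:
  assumes "lex_mono n y"
  shows "\<exists>m z. z 0 = y 0 \<and> z m = y n \<and> (\<forall>i\<le>m. z i \<in> X) \<and> (\<forall>i<m. less_fun (z i) (z (Suc i))) \<and>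
    (\<Sum>i<m. norm (f (z (Suc i)) - f (z i))) = (\<Sum>i<n. norm (f (y (Suc i)) - f (y i) :: complex))"
  using assms
proof (induction n)
  case 0
  then show ?case by (intro exI[of _ 0] exI[of _ y]) (simp add: lex_mono_def)
next
  case (Suc n)
  then have "lex_mono n y" by (simp add: lex_mono_def)
  then obtain m z where z: "z 0 = y 0" "z m = y n" "\<forall>i\<le>m. z i \<in> X"
    "\<forall>i<m. less_fun (z i) (z (Suc i))"
    "(\<Sum>i<m. norm (f (z (Suc i)) - f (z i))) = (\<Sum>i<n. norm (f (y (Suc i)) - f (y i)))"
    using Suc.IH by blast
  have step: "lex_le (y n) (y (Suc n))" "y (Suc n) \<in> X"
    using Suc.prems by (auto simp: lex_mono_def)
  show ?case
  proof (cases "y (Suc n) = y n")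
    case True
    then show ?thesis using z by (intro exI[of _ m] exI[of _ z]) simp
  next
    case False
    then have "less_fun (y n) (y (Suc n))" using step by (auto simp: lex_le_def)
    moreover have "(\<Sum>i<m. norm (f ((z(Suc m := w)) (Suc i)) - f ((z(Suc m := w)) i))) =
      (\<Sum>i<m. norm (f (z (Suc i)) - f (z i)))" for w
      by (intro sum.cong) auto
    ultimately show ?thesis using z step
      by (intro exI[of _ "Suc m"] exI[of _ "z(Suc m := y (Suc n))"])
        (auto simp: less_Suc_eq le_Suc_eq)
  qed
qed

text \<open>A chain is in particular weakly increasing. Conversely, a weakly increasing family is
  prolonged to the least and the greatest point, which can only enlarge the sum, and is then made
  strict.\<close>

lemma var_le_iff: "var_le f B \<longleftrightarrow> var \<beta> f \<le> ereal B"
proof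
  assume B: "var_le f B"
  show "var \<beta> f \<le> ereal B"
    unfolding var_def
  proof (rule SUP_least, clarify)
    fix n x assume "chain \<beta> n x"
    then have "lex_mono n x" by (auto simp: chain_def lex_mono_def lex_le_def)
    with B have "(\<Sum>i<n. norm (f (x (Suc i)) - f (x i))) \<le> B" unfolding var_le_def by blast
    then show "ereal (\<Sum>i=1..n. norm (f (x i) - f (x (i - 1)))) \<le> ereal B"
      by (simp add: sum.atLeast1_atMost_eq)
  qed
next
  assume B: "var \<beta> f \<le> ereal B"
  show "var_le f B"
    unfolding var_le_def
  proof (intro allI impI)
    fix n y assume y: "lex_mono n y"
    \<comment> \<open>Prepending \<open>zeroseq\<close> moves \<open>y i\<close> to position
      \<open>Suc i\<close>; the appended \<open>qone \<beta>\<close> sits at position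
      \<open>Suc (Suc n)\<close>.\<close>
    define y' where "y' = case_nat zeroseq (\<lambda>i. if i \<le> n then y i else qone \<beta>)"
    have "lex_mono (Suc (Suc n)) y'"
      using y qone_in_beta_shift zeroseq_in_beta_shift lex_le_qone
      by (auto simp: lex_mono_def y'_def split: nat.split)
    from lex_mono_strictify[OF this, of f] obtain m z where z: "z 0 = y' 0" "z m = y' (Suc (Suc n))"
      "\<forall>i\<le>m. z i \<in> X" "\<forall>i<m. less_fun (z i) (z (Suc i))"
      and sum: "(\<Sum>i<m. norm (f (z (Suc i)) - f (z i))) =
        (\<Sum>i<Suc (Suc n). norm (f (y' (Suc i)) - f (y' i)))"
      by blast
    have "chain \<beta> m z" using z by (auto simp: chain_def y'_def)
    then have "ereal (\<Sum>i=1..m. norm (f (z i) - f (z (i - 1)))) \<le> var \<beta> f"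
      unfolding var_def by (intro SUP_upper2[of "(m, z)"]) auto
    with B have "(\<Sum>i=1..m. norm (f (z i) - f (z (i - 1)))) \<le> B"
      using order_trans by fastforce
    moreover have "(\<Sum>i<n. norm (f (y (Suc i)) - f (y i))) =
      (\<Sum>i<n. norm (f (y' (Suc (Suc i))) - f (y' (Suc i))))"
      by (intro sum.cong) (auto simp: y'_def)
    then have "(\<Sum>i<n. norm (f (y (Suc i)) - f (y i))) \<le>
      (\<Sum>i<Suc (Suc n). norm (f (y' (Suc i)) - f (y' i)))"
      by (subst sum.lessThan_Suc_shift) simp
    ultimately show "(\<Sum>i<n. norm (f (y (Suc i)) - f (y i))) \<le> B"
      by (simp add: sum sum.atLeast1_atMost_eq)
  qed
qed

lemma BV_iff: "f \<in> BV \<beta> \<longleftrightarrow> (\<exists>B. var_le f B)"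
  unfolding BV_def var_le_iff mem_Collect_eq
  by (cases "var \<beta> f") auto

lemma BV_I: "var_le f B \<Longrightarrow> f \<in> BV \<beta>"
  using BV_iff by blast

lemma var_le_norm:
  assumes "var_le f B" "x \<in> X"
  shows "norm (f x) \<le> norm (f zeroseq) + B"
proof -
  have "lex_mono 1 (\<lambda>i. if i = 0 then zeroseq else x)"
    using assms zeroseq_in_beta_shift by (simp add: lex_mono_def)
  then have "norm (f x - f zeroseq) \<le> B"
    using assms(1) unfolding var_le_def by fastforce
  then show ?thesis using norm_triangle_ineq2[of "f x" "f zeroseq"] by linarith
qed

text \<open>The one-step chain shows that the supremum is taken over a non-empty set; over the empty
  set it would be minus infinity.\<close>

lemma var_nonneg: "0 \<le> var \<beta> f"
proof -
  have "chain \<beta> 1 (\<lambda>i. if i = 0 then zeroseq else qone \<beta>)"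
    using zeroseq_less_qone zeroseq_in_beta_shift qone_in_beta_shift by (simp add: chain_def)
  then show ?thesis
    unfolding var_def by (intro SUP_upper2[of "(1, \<lambda>i. if i = 0 then zeroseq else qone \<beta>)"]) auto
qed

lemma BV_norm_nonneg:
  assumes "f \<in> BV \<beta>"
  shows "0 \<le> BV_norm \<beta> f"
proof -
  obtain B where "var_le f B" using assms BV_iff by blast
  then have "bdd_above ((\<lambda>x. norm (f x)) ` X)"
    by (intro bdd_aboveI2[of _ _ "norm (f zeroseq) + B"] var_le_norm)
  then have "0 \<le> sup_norm \<beta> f" unfolding sup_norm_def
    using zeroseq_in_beta_shift by (intro cSUP_upper2[of _ _ zeroseq]) auto
  then show ?thesis unfolding BV_norm_def using var_nonneg by (simp add: real_of_ereal_pos)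
qed

lemma BV_norm_le:
  assumes "var_le f B" "\<And>x. x \<in> X \<Longrightarrow> norm (f x) \<le> C"
  shows "BV_norm \<beta> f \<le> C + B"
proof -
  have "sup_norm \<beta> f \<le> C" unfolding sup_norm_def
    using zeroseq_in_beta_shift assms(2) by (intro cSUP_least) auto
  moreover have "real_of_ereal (var \<beta> f) \<le> B"
    using assms(1) var_nonneg[of f] unfolding var_le_iff by (cases "var \<beta> f") auto
  ultimately show ?thesis unfolding BV_norm_def by linarith
qed

section \<open>Variation of sums, multiples, compositions, indicators and series\<close>

lemma var_le_cong:
  assumes "var_le f B" "\<And>x. x \<in> X \<Longrightarrow> f x = g x"
  shows "var_le g B"
  unfolding var_le_def
proof (intro allI impI)
  fix n y assume y: "lex_mono n y"
  have "(\<Sum>i<n. norm (g (y (Suc i)) - g (y i))) = (\<Sum>i<n. norm (f (y (Suc i)) - f (y i)))"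
    using y assms(2) by (intro sum.cong) (auto simp: lex_mono_def)
  with y assms(1) show "(\<Sum>i<n. norm (g (y (Suc i)) - g (y i))) \<le> B"
    unfolding var_le_def by simp
qed

lemma var_le_add:
  assumes "var_le f B" "var_le g C"
  shows "var_le (\<lambda>x. f x + g x) (B + C)"
  unfolding var_le_def
proof (intro allI impI)
  fix n y assume y: "lex_mono n y"
  have "(\<Sum>i<n. norm (f (y (Suc i)) + g (y (Suc i)) - (f (y i) + g (y i)))) \<le>
    (\<Sum>i<n. norm (f (y (Suc i)) - f (y i)) + norm (g (y (Suc i)) - g (y i)))"
    by (intro sum_mono norm_diff_triangle_ineq)
  also have "\<dots> \<le> B + C"
    using assms y unfolding var_le_def sum.distrib by (intro add_mono) auto
  finally show "(\<Sum>i<n. norm (f (y (Suc i)) + g (y (Suc i)) - (f (y i) + g (y i)))) \<le> B + C" .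
qed

lemma var_le_scale:
  assumes "var_le f B"
  shows "var_le (\<lambda>x. c * f x) (norm c * B)"
  using assms unfolding var_le_def
  by (simp flip: right_diff_distrib sum_distrib_left add: norm_mult mult_left_mono)

lemma var_le_compose:
  assumes "var_le f B" "\<And>x. x \<in> X \<Longrightarrow> m x \<in> X"
    and "\<And>x y. x \<in> X \<Longrightarrow> y \<in> X \<Longrightarrow> lex_le x y \<Longrightarrow> lex_le (m x) (m y)"
  shows "var_le (\<lambda>x. f (m x)) B"
  unfolding var_le_def
proof (intro allI impI)
  fix n y assume "lex_mono n y"
  then have "lex_mono n (\<lambda>i. m (y i))" using assms(2,3) by (simp add: lex_mono_def)
  then show "(\<Sum>i<n. norm (f (m (y (Suc i))) - f (m (y i)))) \<le> B"
    using assms(1) unfolding var_le_def by blast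
qed

lemma indicator_initial_interval:
  "x \<in> X \<Longrightarrow> indicator (interval \<beta> zeroseq b) x = (if lex_le x b then 1 else 0)"
  by (simp add: interval_def indicator_def)

text \<open>Along a weakly increasing chain the indicator only decreases, so the absolute
  differences telescope.\<close>

lemma var_le_indicator: "var_le (indicator (interval \<beta> zeroseq b)) 1"
  unfolding var_le_def
proof (intro allI impI)
  fix n y assume y: "lex_mono n y"
  let ?f = "indicator (interval \<beta> zeroseq b) :: symb \<Rightarrow> real"
  have "(\<Sum>i<n. norm (indicator (interval \<beta> zeroseq b) (y (Suc i)) -
      indicator (interval \<beta> zeroseq b) (y i) :: complex)) = (\<Sum>i<n. ?f (y i) - ?f (y (Suc i)))"
  proof (intro sum.cong refl)
    fix i assume "i \<in> {..<n}"
    then have "y i \<in> X" "y (Suc i) \<in> X" "lex_le (y i) (y (Suc i))"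
      using y by (auto simp: lex_mono_def)
    then show "norm (indicator (interval \<beta> zeroseq b) (y (Suc i)) -
      indicator (interval \<beta> zeroseq b) (y i) :: complex) = ?f (y i) - ?f (y (Suc i))"
      by (auto simp: indicator_initial_interval intro: lex_le_trans)
  qed
  also have "\<dots> = ?f (y 0) - ?f (y n)" by (rule sum_lessThan_telescope')
  also have "\<dots> \<le> 1" by (auto simp: indicator_def)
  finally show "(\<Sum>i<n. norm (indicator (interval \<beta> zeroseq b) (y (Suc i)) -
      indicator (interval \<beta> zeroseq b) (y i) :: complex)) \<le> 1" .
qed

text \<open>The sum along a chain is finite and can be exchanged with the series. The three
  conclusions together control the norm of \<open>BV\<close>; they serve both for the eigenfunction
  and for the tails of its series.\<close>

lemma var_le_suminf:
  fixes c :: "nat \<Rightarrow> complex"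
  assumes c: "summable (\<lambda>n. norm (c n))"
    and var: "\<And>n. var_le (f n) 1" and norm: "\<And>n x. x \<in> X \<Longrightarrow> norm (f n x) \<le> 1"
  shows "var_le (\<lambda>x. \<Sum>n. c n * f n x) (\<Sum>n. norm (c n))"
    and "x \<in> X \<Longrightarrow> summable (\<lambda>n. c n * f n x)"
    and "x \<in> X \<Longrightarrow> norm (\<Sum>n. c n * f n x) \<le> (\<Sum>n. norm (c n))"
proof -
  have bound: "norm (c n * f n x) \<le> norm (c n)" if "x \<in> X" for x n
    using norm[OF that, of n] by (simp add: norm_mult mult_left_le)
  show sm: "summable (\<lambda>n. c n * f n x)" if "x \<in> X" for x
    by (rule summable_comparison_test'[OF c, of 0]) (rule bound[OF that])
  show "norm (\<Sum>n. c n * f n x) \<le> (\<Sum>n. norm (c n))" if "x \<in> X" for x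
    by (rule norm_suminf_le[OF bound[OF that] c])
  show "var_le (\<lambda>x. \<Sum>n. c n * f n x) (\<Sum>n. norm (c n))"
    unfolding var_le_def
  proof (intro allI impI)
    fix m y assume y: "lex_mono m y"
    let ?d = "\<lambda>i n. norm (f n (y (Suc i)) - f n (y i))"
    have sd: "summable (\<lambda>n. norm (c n) * ?d i n)" if "i < m" for i
    proof (rule summable_comparison_test'[where N = 0])
      show "summable (\<lambda>n. norm (c n) * 2)" using c by (rule summable_mult2)
      \<comment> \<open>This crude bound from the sup norm serves only for summability; the bound 1
        on the variation enters after summing over \<open>i\<close>.\<close>
      have "?d i n \<le> 2" for n
        using norm_triangle_ineq4[of "f n (y (Suc i))" "f n (y i)"] norm[of "y i" n]
          norm[of "y (Suc i)" n] y that by (auto simp: lex_mono_def)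
      then show "norm (norm (c n) * ?d i n) \<le> norm (c n) * 2" for n
        by (simp add: mult_left_mono)
    qed
    have "(\<Sum>i<m. norm ((\<Sum>n. c n * f n (y (Suc i))) - (\<Sum>n. c n * f n (y i)))) \<le>
      (\<Sum>i<m. \<Sum>n. norm (c n) * ?d i n)"
    proof (rule sum_mono)
      fix i assume "i \<in> {..<m}"
      then have i: "i < m" "y i \<in> X" "y (Suc i) \<in> X" using y by (auto simp: lex_mono_def)
      have "(\<Sum>n. c n * f n (y (Suc i))) - (\<Sum>n. c n * f n (y i)) =
        (\<Sum>n. c n * (f n (y (Suc i)) - f n (y i)))"
        using suminf_diff[OF sm[OF i(3)] sm[OF i(2)]] by (simp add: right_diff_distrib)
      also have "norm \<dots> \<le> (\<Sum>n. norm (c n) * ?d i n)"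
        by (rule norm_suminf_le[OF _ sd[OF i(1)]]) (simp add: norm_mult)
      finally show "norm ((\<Sum>n. c n * f n (y (Suc i))) - (\<Sum>n. c n * f n (y i))) \<le>
        (\<Sum>n. norm (c n) * ?d i n)" .
    qed
    also have "\<dots> = (\<Sum>n. \<Sum>i<m. norm (c n) * ?d i n)"
      by (rule suminf_sum[symmetric]) (use sd in auto)
    also have "\<dots> \<le> (\<Sum>n. norm (c n))"
    proof (rule suminf_le[OF _ _ c])
      show "(\<Sum>i<m. norm (c n) * ?d i n) \<le> norm (c n)" for n
        using var[of n] y by (simp flip: sum_distrib_left add: var_le_def mult_left_le)
      show "summable (\<lambda>n. \<Sum>i<m. norm (c n) * ?d i n)"
        by (rule summable_sum) (use sd in auto)
    qed
    finally show "(\<Sum>i<m. norm ((\<Sum>n. c n * f n (y (Suc i))) - (\<Sum>n. c n * f n (y i)))) \<le>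
      (\<Sum>n. norm (c n))" .
  qed
qed

section \<open>The quotient space\<close>

lemma BV_add: "f \<in> BV \<beta> \<Longrightarrow> g \<in> BV \<beta> \<Longrightarrow> (\<lambda>x. f x + g x) \<in> BV \<beta>"
  unfolding BV_iff using var_le_add by blast

lemma BV_scale: "f \<in> BV \<beta> \<Longrightarrow> (\<lambda>x. c * f x) \<in> BV \<beta>"
  unfolding BV_iff using var_le_scale by blast

lemma BV_diff: "f \<in> BV \<beta> \<Longrightarrow> g \<in> BV \<beta> \<Longrightarrow> (\<lambda>x. f x - g x) \<in> BV \<beta>"
  using BV_add[of f "\<lambda>x. (-1) * g x"] BV_scale[of g "-1"] by simp

text \<open>In this form, compatibility of an operation with the relation becomes an inclusion
  between exceptional sets.\<close>

lemma BV_rel_iff: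
  "(f, g) \<in> BV_rel \<beta> \<longleftrightarrow> f \<in> BV \<beta> \<and> g \<in> BV \<beta> \<and> countable {x \<in> X. f x \<noteq> g x}"
  using BV_diff[of f g] by (auto simp: BV_rel_def null_BV_def)

lemma equiv_BV_rel: "equiv (BV \<beta>) (BV_rel \<beta>)"
proof (rule equivI)
  show "trans (BV_rel \<beta>)"
  proof (rule transI)
    fix f g h assume "(f, g) \<in> BV_rel \<beta>" "(g, h) \<in> BV_rel \<beta>"
    moreover have "{x \<in> X. f x \<noteq> h x} \<subseteq> {x \<in> X. f x \<noteq> g x} \<union> {x \<in> X. g x \<noteq> h x}" by auto
    ultimately show "(f, h) \<in> BV_rel \<beta>"
      unfolding BV_rel_iff by (auto intro: countable_subset[OF _ countable_Un])
  qed
  show "sym (BV_rel \<beta>)" by (rule symI) (simp add: BV_rel_iff eq_commute)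
qed (auto simp: refl_on_def BV_rel_iff)

lemma mem_cls: "f \<in> cls \<beta> g \<longleftrightarrow> (g, f) \<in> BV_rel \<beta>"
  by (simp add: cls_def)

lemma cls_eqI: "(f, g) \<in> BV_rel \<beta> \<Longrightarrow> cls \<beta> f = cls \<beta> g"
  unfolding cls_def by (rule equiv_class_eq[OF equiv_BV_rel])

lemma cls_self: "f \<in> BV \<beta> \<Longrightarrow> f \<in> cls \<beta> f"
  by (simp add: mem_cls BV_rel_iff)

text \<open>Operations on classes are unions over representatives. If \<open>F\<close> respects the
  relation, all members of the union are the same class.\<close>

lemma cls_UN:
  assumes "f \<in> BV \<beta>" "\<And>f'. (f, f') \<in> BV_rel \<beta> \<Longrightarrow> (F f, F f') \<in> BV_rel \<beta>"
  shows "(\<Union>f'\<in>cls \<beta> f. cls \<beta> (F f')) = cls \<beta> (F f)"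
  by (rule UN_constant_eq[OF cls_self[OF assms(1)]]) (metis assms(2) cls_eqI mem_cls)

lemma cls_scale_cls:
  assumes "f \<in> BV \<beta>"
  shows "cls_scale \<beta> c (cls \<beta> f) = cls \<beta> (\<lambda>x. c * f x)"
  unfolding cls_scale_def
proof (rule cls_UN[OF assms])
  fix f' assume "(f, f') \<in> BV_rel \<beta>"
  moreover have "{x \<in> X. c * f x \<noteq> c * f' x} \<subseteq> {x \<in> X. f x \<noteq> f' x}" by auto
  ultimately show "(\<lambda>x. c * f x, \<lambda>x. c * f' x) \<in> BV_rel \<beta>"
    unfolding BV_rel_iff using BV_scale countable_subset by blast
qed

lemma BV_rel_add:
  assumes "(f, f') \<in> BV_rel \<beta>" "(g, g') \<in> BV_rel \<beta>"
  shows "(\<lambda>x. f x + g x, \<lambda>x. f' x + g' x) \<in> BV_rel \<beta>"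
proof -
  have "{x \<in> X. f x + g x \<noteq> f' x + g' x} \<subseteq> {x \<in> X. f x \<noteq> f' x} \<union> {x \<in> X. g x \<noteq> g' x}" by auto
  then have "countable {x \<in> X. f x + g x \<noteq> f' x + g' x}"
    using assms unfolding BV_rel_iff by (auto intro: countable_subset[OF _ countable_Un])
  then show ?thesis using assms BV_add unfolding BV_rel_iff by simp
qed

lemma cls_add_cls:
  assumes "f \<in> BV \<beta>" "g \<in> BV \<beta>"
  shows "cls_add \<beta> (cls \<beta> f) (cls \<beta> g) = cls \<beta> (\<lambda>x. f x + g x)"
proof -
  have refl: "(h, h) \<in> BV_rel \<beta>" if "h \<in> BV \<beta>" for h using that by (simp add: BV_rel_iff)
  \<comment> \<open>The double union is collapsed one variable at a time, first over
    \<open>g'\<close> with \<open>f'\<close> fixed.\<close>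
  have "(\<Union>g'\<in>cls \<beta> g. cls \<beta> (\<lambda>x. f' x + g' x)) = cls \<beta> (\<lambda>x. f' x + g x)"
    if "f' \<in> cls \<beta> f" for f'
    using that by (intro cls_UN assms BV_rel_add refl) (auto simp: mem_cls BV_rel_iff)
  then have "cls_add \<beta> (cls \<beta> f) (cls \<beta> g) = (\<Union>f'\<in>cls \<beta> f. cls \<beta> (\<lambda>x. f' x + g x))"
    unfolding cls_add_def by simp
  also have "\<dots> = cls \<beta> (\<lambda>x. f x + g x)"
    by (intro cls_UN assms BV_rel_add refl)
  finally show ?thesis .
qed

lemma quot_norm_cls_le:
  assumes "f \<in> BV \<beta>"
  shows "quot_norm \<beta> (cls \<beta> f) \<le> BV_norm \<beta> f"
  unfolding quot_norm_def
proof (rule cINF_lower)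
  show "bdd_below (BV_norm \<beta> ` cls \<beta> f)"
    using BV_norm_nonneg by (intro bdd_belowI2[of _ 0]) (auto simp: mem_cls BV_rel_iff)
qed (rule cls_self[OF assms])

section \<open>The transfer operator\<close>

text \<open>Since \<open>qone \<beta>\<close> begins with 1, prepending 0 is always admissible,
  while after a prepended 1 the tails must still be compared.\<close>

lemma case_nat_in_beta_shift:
  "case_nat a x \<in> X \<longleftrightarrow> x \<in> X \<and> (a = 0 \<or> a = 1 \<and> lex_le x (shift (qone \<beta>)))"
  unfolding beta_shift_unfold[of "case_nat a x"] lex_le_unfold[of "case_nat a x"]
  by (auto simp: qone_0)

text \<open>The two inverse branches of \<open>shift\<close> made explicit: the branch 0 has weight
  1, the branch 1 has weight \<open>exp t\<close> and exists only up to
  \<open>shift (qone \<beta>)\<close>.\<close>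

lemma transfer_fun_eq:
  assumes "x \<in> X"
  shows "transfer_fun \<beta> t f x = f (case_nat 0 x) +
    (if lex_le x (shift (qone \<beta>)) then of_real (exp t) * f (case_nat 1 x) else 0)"
proof -
  have "{y \<in> X. shift y = x} = insert (case_nat 0 x)
    (if lex_le x (shift (qone \<beta>)) then {case_nat 1 x} else {})" (is "?L = ?R")
  proof (rule set_eqI)
    fix y
    have "y \<in> ?L \<longleftrightarrow> y = case_nat (y 0) x \<and> case_nat (y 0) x \<in> X"
      using case_nat_shift[of y] shift_case_nat[of "y 0" x] by (metis (mono_tags) mem_Collect_eq)
    also have "\<dots> \<longleftrightarrow> y \<in> ?R"
      using assms unfolding case_nat_in_beta_shift by (auto simp: fun_eq_iff split: nat.splits)
    finally show "y \<in> ?L \<longleftrightarrow> y \<in> ?R" .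
  qed
  moreover have "case_nat 0 x \<noteq> case_nat 1 x" by (auto simp: fun_eq_iff intro!: exI[of _ 0])
  ultimately show ?thesis
    using assms case_nat_in_beta_shift[of 0 x] case_nat_in_beta_shift[of 1 x]
    by (simp add: transfer_fun_def cyl1_def indicator_def)
qed

text \<open>Shift invariance leaves such a point without preimages, so the sum is empty. This makes
  the eigenvalue equation an equality of total functions.\<close>

lemma transfer_fun_outside:
  assumes "x \<notin> X"
  shows "transfer_fun \<beta> t f x = 0"
proof -
  have "{y \<in> X. shift y = x} = {}" using assms beta_shift_unfold by blast
  then show ?thesis by (simp only: transfer_fun_def sum.empty)
qed

lemma transfer_BV:
  assumes "f \<in> BV \<beta>"
  shows "transfer_fun \<beta> t f \<in> BV \<beta>"
proof -
  obtain B where B: "var_le f B" using assms BV_iff by blast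
  \<comment> \<open>\<open>m\<close> extends the inverse branch \<open>x \<mapsto> 1x\<close>, which exists only up to \<open>shift (qone \<beta>)\<close>, to a
    monotone self-map; the indicator \<open>?I\<close> below removes the extension.\<close>
  define m where "m x = (if lex_le x (shift (qone \<beta>)) then case_nat 1 x else qone \<beta>)" for x
  let ?I = "indicator (interval \<beta> zeroseq (shift (qone \<beta>))) :: cfun"
  have cons: "lex_le (case_nat a x) (case_nat a y) \<longleftrightarrow> lex_le x y" for a x y
    by (subst lex_le_unfold) simp
  have v0: "var_le (\<lambda>x. f (case_nat 0 x)) B"
    using B by (rule var_le_compose) (auto simp: case_nat_in_beta_shift cons)
  have v1: "var_le (\<lambda>x. f (m x)) B"
  proof (rule var_le_compose[OF B])
    show "m x \<in> X" if "x \<in> X" for x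
      using that qone_in_beta_shift by (simp add: m_def case_nat_in_beta_shift)
    then show "lex_le (m x) (m y)" if "x \<in> X" "y \<in> X" "lex_le x y" for x y
      using that lex_le_qone[of "m x"] lex_le_trans[of x y "shift (qone \<beta>)"]
      by (auto simp: m_def cons)
  qed
  let ?h = "\<lambda>x. f (case_nat 0 x) + (of_real (exp t) * f (m x) +
    (- of_real (exp t) * f (qone \<beta>) + of_real (exp t) * f (qone \<beta>) * ?I x))"
  have "?h \<in> BV \<beta>"
  proof (intro BV_add BV_scale)
    show "(\<lambda>_. f (qone \<beta>)) \<in> BV \<beta>"
      by (rule BV_I[of _ 0]) (simp add: var_le_def)
  qed (use v0 v1 var_le_indicator BV_I in auto)
  moreover have "?h x = transfer_fun \<beta> t f x" if "x \<in> X" for x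
    using that by (simp add: transfer_fun_eq indicator_initial_interval m_def algebra_simps)
  ultimately show ?thesis unfolding BV_iff using var_le_cong by blast
qed

text \<open>Images of equivalent functions can differ at \<open>x\<close> only if the functions
  differ at a preimage of \<open>x\<close>, and the \<open>shift\<close> image of a countable set is
  countable.\<close>

lemma transfer_op_cls:
  assumes "f \<in> BV \<beta>"
  shows "transfer_op \<beta> t (cls \<beta> f) = cls \<beta> (transfer_fun \<beta> t f)"
  unfolding transfer_op_def
proof (rule cls_UN[OF assms])
  fix f' assume rel: "(f, f') \<in> BV_rel \<beta>"
  have "{x \<in> X. transfer_fun \<beta> t f x \<noteq> transfer_fun \<beta> t f' x} \<subseteq> shift ` {x \<in> X. f x \<noteq> f' x}"
  proof (rule subsetI, rule ccontr)
    fix x assume x: "x \<in> {x \<in> X. transfer_fun \<beta> t f x \<noteq> transfer_fun \<beta> t f' x}"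
      and "x \<notin> shift ` {x \<in> X. f x \<noteq> f' x}"
    then have "\<And>y. y \<in> X \<Longrightarrow> shift y = x \<Longrightarrow> f y = f' y" by blast
    then have "transfer_fun \<beta> t f x = transfer_fun \<beta> t f' x"
      unfolding transfer_fun_def by (intro sum.cong) auto
    with x show False by simp
  qed
  then have "countable {x \<in> X. transfer_fun \<beta> t f x \<noteq> transfer_fun \<beta> t f' x}"
    using rel unfolding BV_rel_iff by (meson countable_image countable_subset)
  then show "(transfer_fun \<beta> t f, transfer_fun \<beta> t f') \<in> BV_rel \<beta>"
    using rel transfer_BV unfolding BV_rel_iff by blast
qed

text \<open>If \<open>b\<close> begins with 0, only the branch 0 can meet the interval, and it does
  so for \<open>x\<close> up to \<open>shift b\<close>. If \<open>b\<close> begins with 1, the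
  branch 0 lies wholly inside and gives the constant, while the branch 1 contributes up to
  \<open>shift b\<close>, where it is defined because \<open>shift b\<close> is below
  \<open>shift (qone \<beta>)\<close>.\<close>

lemma transfer_fun_indicator:
  assumes "x \<in> X" "b \<in> X"
  shows "transfer_fun \<beta> t (indicator (interval \<beta> zeroseq b)) x =
    of_nat (b 0) + of_real (exp (t * b 0)) * indicator (interval \<beta> zeroseq (shift b)) x"
proof -
  have b: "b 0 = 0 \<or> b 0 = 1 \<and> lex_le (shift b) (shift (qone \<beta>))"
    using assms(2) lex_le_unfold[of b "qone \<beta>"] unfolding beta_shift_unfold[of b] by (auto simp: qone_0)
  have le: "lex_le (case_nat a x) b \<longleftrightarrow> a < b 0 \<or> a = b 0 \<and> lex_le x (shift b)" for a
    by (subst lex_le_unfold) simp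
  show ?thesis
    using b
  proof (elim disjE conjE)
    assume "b 0 = 1" "lex_le (shift b) (shift (qone \<beta>))"
    then show ?thesis
      using assms lex_le_trans[of x "shift b" "shift (qone \<beta>)"]
      by (simp add: transfer_fun_eq indicator_initial_interval case_nat_in_beta_shift le)
  qed (use assms in \<open>simp add: transfer_fun_eq indicator_initial_interval case_nat_in_beta_shift le\<close>)
qed

end

section \<open>The eigenfunction\<close>

text \<open>The cocycle identity: the exponents add along the orbit.\<close>

lemma H_add: "H (m + n) t x = H m t x * H n t ((shift ^^ m) x)"
proof -
  have "(\<Sum>i<m + n. real (x i)) = (\<Sum>i<m. real (x i)) + (\<Sum>i<n. real ((shift ^^ m) x i))"
    by (induction n) (simp_all add: shift_funpow add.commute)
  then show ?thesis by (simp add: H_def distrib_left exp_add)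
qed

context beta_numeration
begin

text \<open>The orbit of \<open>qone \<beta>\<close> stays in the beta-shift and visits
  \<open>cyl1 \<beta>\<close> exactly at the digits 1, so the left side is a value of the function
  under the supremum.\<close>

lemma H_qone_le_sup_norm:
  "H n t (qone \<beta>) \<le> sup_norm \<beta> (\<lambda>x. exp (t * birkhoff (indicator (cyl1 \<beta>)) n x))"
proof -
  let ?b = "birkhoff (indicator (cyl1 \<beta>)) n"
  have "qone \<beta> i \<in> {0, 1}" for i
    using qone_in_beta_shift by (simp add: beta_shift_def)
  then have "indicator (cyl1 \<beta>) ((shift ^^ i) (qone \<beta>)) = real (qone \<beta> i)" for i
    using shift_funpow_in_beta_shift[OF qone_in_beta_shift, of i]
    by (fastforce simp: cyl1_def indicator_def shift_funpow)
  then have "H n t (qone \<beta>) = norm (exp (t * ?b (qone \<beta>)))"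
    by (simp add: H_def birkhoff_def)
  moreover have "norm (exp (t * ?b x)) \<le> exp (\<bar>t\<bar> * n)" for x
  proof -
    have "\<bar>?b x\<bar> \<le> (\<Sum>i<n. 1)" unfolding birkhoff_def
      by (rule order_trans[OF sum_abs sum_mono]) (simp add: indicator_def)
    then have "\<bar>t * ?b x\<bar> \<le> \<bar>t\<bar> * n" by (simp add: abs_mult mult_left_mono)
    then show ?thesis by simp
  qed
  then have "bdd_above ((\<lambda>x. norm (exp (t * ?b x))) ` X)" by (intro bdd_aboveI2)
  ultimately show ?thesis
    unfolding sup_norm_def using qone_in_beta_shift by (metis (no_types, lifting) cSUP_upper)
qed

text \<open>Inversion reverses the inequality for a positive rate. A non-positive rate is below the
  positive number \<open>norm lam\<close>, and an infinite one has inverse 0, contradicting the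
  bound.\<close>

lemma growth_rate_less:
  assumes "lam \<noteq> 0" "ereal (norm (inverse lam)) < inverse (growth_rate \<beta> t)"
  shows "growth_rate \<beta> t < ereal (norm (lam :: complex))"
proof (cases "growth_rate \<beta> t")
  case (real r)
  show ?thesis
  proof (cases "r \<le> 0")
    case True
    have "0 < norm lam" using assms by simp
    with True show ?thesis using real by (simp del: zero_less_norm_iff)
  next
    case False
    then have "inverse (norm lam) < inverse r" using assms real by (simp add: norm_inverse)
    then show ?thesis using real False assms by (simp add: inverse_less_iff_less)
  qed
qed (use assms in auto)

text \<open>Root test: for \<open>C\<close> strictly between the growth rate and
  \<open>norm lam\<close>, the geometric series with ratio \<open>C / norm lam\<close> eventually
  dominates.\<close>

lemma summable_coeff:
  assumes "lam \<noteq> 0" "ereal (norm (inverse lam)) < inverse (growth_rate \<beta> t)"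
  shows "summable (\<lambda>n. norm (of_real (H n t (qone \<beta>)) / lam ^ n :: complex))"
proof -
  let ?s = "\<lambda>n. sup_norm \<beta> (\<lambda>x. exp (t * birkhoff (indicator (cyl1 \<beta>)) n x))"
  \<comment> \<open>The maximum with 0 forces \<open>C\<close> to be positive.\<close>
  have "max 0 (growth_rate \<beta> t) < ereal (norm lam)"
    using growth_rate_less[OF assms] assms(1) by simp
  then obtain C where C: "max 0 (growth_rate \<beta> t) < ereal C" "ereal C < ereal (norm lam)"
    using ereal_dense2 by blast
  then have "0 < C" "C < norm lam" by simp_all
  have "\<forall>\<^sub>F n in sequentially. ereal (root n (?s n)) < ereal C"
    using C(1) unfolding growth_rate_def by (intro Limsup_lessD) simp
  then have "\<forall>\<^sub>F n in sequentially. norm (norm (of_real (H n t (qone \<beta>)) / lam ^ n)) \<le> (C / norm lam) ^ n"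
    using eventually_gt_at_top[of 0]
  proof eventually_elim
    case (elim n)
    have s: "0 \<le> ?s n" using H_qone_le_sup_norm[of n t] by (rule order_trans[rotated]) (simp add: H_def)
    have "H n t (qone \<beta>) \<le> root n (?s n) ^ n"
      using H_qone_le_sup_norm[of n t] s elim by simp
    also have "\<dots> \<le> C ^ n" using elim s by (intro power_mono) simp_all
    finally show ?case
      by (simp add: norm_divide norm_power power_divide divide_right_mono H_def)
  qed
  moreover have "summable (\<lambda>n. (C / norm lam) ^ n)"
    using \<open>0 < C\<close> \<open>C < norm lam\<close> by (intro summable_geometric) (simp add: divide_less_eq)
  ultimately show ?thesis by (rule summable_comparison_test_ev)
qed

text \<open>If \<open>k\<close> is a return time of \<open>qone \<beta>\<close>, the interval is the
  whole beta-shift. Otherwise its right end is strictly below \<open>qone \<beta>\<close>, and the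
  greedy digits eventually exceed it.\<close>

lemma digits_indicator_tendsto:
  "\<forall>\<^sub>F y in at_left 1. indicator (interval \<beta> zeroseq ((shift ^^ k) (qone \<beta>))) (digits y) =
    (if (shift ^^ k) (qone \<beta>) = qone \<beta> then 1 else 0 :: complex)"
proof (cases "(shift ^^ k) (qone \<beta>) = qone \<beta>")
  case True
  show ?thesis
    using eventually_unit_interval
    by eventually_elim
      (simp add: True digits_in_beta_shift digits_le_qone indicator_initial_interval)
next
  case False
  then have "less_fun ((shift ^^ k) (qone \<beta>)) (qone \<beta>)"
    using lex_le_qone[OF shift_funpow_in_beta_shift[OF qone_in_beta_shift], of k]
    by (simp add: lex_le_def)
  then have "\<forall>\<^sub>F y in at_left 1. less_fun ((shift ^^ k) (qone \<beta>)) (digits y)"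
    by (rule eventually_less_fun[OF tendsto_const digits_tendsto_qone])
  then show ?thesis
    using eventually_unit_interval
    by eventually_elim
      (simp add: False digits_in_beta_shift indicator_initial_interval flip: not_lex_le)
qed

context
  fixes t :: real and lam :: complex
  assumes lam: "lam \<noteq> 0" and summable_coeff_norm: "summable (\<lambda>n. norm (of_real (H n t (qone \<beta>)) / lam ^ n))"
begin

section \<open>The series and its coefficients\<close>

definition gcoeff :: "nat \<Rightarrow> complex" where
  "gcoeff n = of_real (H n t (qone \<beta>)) / lam ^ n"

definition gstep :: "nat \<Rightarrow> cfun" where
  "gstep n = indicator (interval \<beta> zeroseq ((shift ^^ n) (qone \<beta>)))"

lemma summable_norm_gcoeff: "summable (\<lambda>n. norm (gcoeff n))"
  using summable_coeff_norm by (simp add: gcoeff_def)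

lemma g_term_eq: "g_term \<beta> t lam n x = gcoeff n * gstep n x"
  by (simp add: g_term_def gcoeff_def gstep_def)

lemma g_fun_eq: "g_fun \<beta> t lam = (\<lambda>x. \<Sum>n. gcoeff n * gstep n x)"
  by (rule ext) (simp add: g_fun_def g_term_eq)

lemma var_le_gstep: "var_le (gstep n) 1"
  unfolding gstep_def by (rule var_le_indicator)

lemma norm_gstep_le: "norm (gstep n x) \<le> 1"
  by (simp add: gstep_def indicator_def)

lemma gcoeff_add:
  assumes "(shift ^^ m) (qone \<beta>) = qone \<beta>"
  shows "gcoeff (n + m) = gcoeff m * gcoeff n"
  using assms H_add[of m n t "qone \<beta>"] by (simp add: gcoeff_def power_add add.commute mult.commute)

lemma summable_g_term:
  assumes "x \<in> X"
  shows "summable (\<lambda>n. gcoeff n * gstep n x)"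
  using var_le_suminf(2)[OF summable_norm_gcoeff var_le_gstep norm_gstep_le assms] .

lemma g_fun_BV: "g_fun \<beta> t lam \<in> BV \<beta>"
  unfolding g_fun_eq by (rule BV_I[OF var_le_suminf(1)[OF summable_norm_gcoeff var_le_gstep norm_gstep_le]])

text \<open>The partial sums lie in the span of the intervals, and both the supremum and the
  variation of the remainder are bounded by the tail of the coefficient norms.\<close>

lemma g_fun_in_Fspace: "cls \<beta> (g_fun \<beta> t lam) \<in> Fspace \<beta>"
proof -
  let ?g = "g_fun \<beta> t lam"
  have "\<exists>s\<in>interval_span \<beta>. quot_norm \<beta> (cls_add \<beta> (cls \<beta> ?g) (cls_scale \<beta> (-1) (cls \<beta> s))) < \<epsilon>"
    if pos: "\<epsilon> > 0" for \<epsilon>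
  proof -
    \<comment> \<open>Half of \<epsilon>, because the tail enters the norm twice.\<close>
    obtain N where "norm (\<Sum>n. norm (gcoeff (n + N))) < \<epsilon> / 2"
      using suminf_exist_split[OF half_gt_zero[OF pos] summable_norm_gcoeff] by blast
    then have N: "(\<Sum>n. norm (gcoeff (n + N))) < \<epsilon> / 2" by simp
    define s where "s x = (\<Sum>i<N. gcoeff i * gstep i x)" for x
    have s_span: "s \<in> interval_span \<beta>"
      unfolding interval_span_def s_def gstep_def
      using zeroseq_in_beta_shift shift_funpow_in_beta_shift[OF qone_in_beta_shift]
      by (intro CollectI exI[of _ N] exI[of _ gcoeff] exI[of _ "\<lambda>_. zeroseq"]
          exI[of _ "\<lambda>i. (shift ^^ i) (qone \<beta>)"]) auto
    have tail: "?g x + (-1) * s x = (\<Sum>n. gcoeff (n + N) * gstep (n + N) x)" if "x \<in> X" for x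
      using suminf_minus_initial_segment[OF summable_g_term[OF that], of N]
      by (simp add: g_fun_eq s_def)
    have sum_tail: "summable (\<lambda>n. norm (gcoeff (n + N)))"
      using summable_norm_gcoeff by (rule summable_ignore_initial_segment)
    note tail_bounds = var_le_suminf[where ?f = "\<lambda>n. gstep (n + N)", OF sum_tail var_le_gstep norm_gstep_le]
    have var: "var_le (\<lambda>x. ?g x + (-1) * s x) (\<Sum>n. norm (gcoeff (n + N)))"
      by (rule var_le_cong[OF tail_bounds(1)]) (simp only: tail)
    have sup: "norm (?g x + (-1) * s x) \<le> (\<Sum>n. norm (gcoeff (n + N)))" if "x \<in> X" for x
      unfolding tail[OF that] by (rule tail_bounds(3)[OF that])
    have "s \<in> BV \<beta>"
    proof -
      have "(\<lambda>x. \<Sum>i<n. gcoeff i * gstep i x) \<in> BV \<beta>" for n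
      proof (induction n)
        case 0
        show ?case by (rule BV_I[of _ 0]) (simp add: var_le_def)
      next
        case (Suc n)
        have "(\<lambda>x. gcoeff n * gstep n x) \<in> BV \<beta>" by (intro BV_scale BV_I[OF var_le_gstep])
        with Suc show ?case by (simp add: BV_add)
      qed
      then show ?thesis by (simp add: s_def[abs_def])
    qed
    then have "cls_add \<beta> (cls \<beta> ?g) (cls_scale \<beta> (-1) (cls \<beta> s)) = cls \<beta> (\<lambda>x. ?g x + (-1) * s x)"
      by (simp only: cls_scale_cls cls_add_cls g_fun_BV BV_scale)
    then have "quot_norm \<beta> (cls_add \<beta> (cls \<beta> ?g) (cls_scale \<beta> (-1) (cls \<beta> s))) \<le>
      BV_norm \<beta> (\<lambda>x. ?g x + (-1) * s x)"
      using quot_norm_cls_le[OF BV_I[OF var]] by simp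
    also have "\<dots> \<le> (\<Sum>n. norm (gcoeff (n + N))) + (\<Sum>n. norm (gcoeff (n + N)))"
      using var sup by (rule BV_norm_le)
    also have "\<dots> < \<epsilon>" using N by simp
    finally show ?thesis using s_span by blast
  qed
  then show ?thesis
    unfolding Fspace_def Bspace_def using g_fun_BV by (auto simp: cls_def intro: quotientI)
qed

lemma transfer_fun_g_fun:
  assumes "1 - phi \<beta> t (inverse lam) = 0"
  shows "transfer_fun \<beta> t (g_fun \<beta> t lam) = (\<lambda>x. lam * g_fun \<beta> t lam x)"
proof
  fix x
  let ?q = "qone \<beta>"
  have summable_cq: "summable (\<lambda>n. gcoeff n * of_nat (?q n))"
  proof (rule summable_comparison_test'[OF summable_norm_gcoeff, of 0])
    fix n
    have "?q n \<in> {0, 1}" using qone_in_beta_shift by (simp add: beta_shift_def)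
    then show "norm (gcoeff n * of_nat (?q n)) \<le> norm (gcoeff n)" by auto
  qed
  show "transfer_fun \<beta> t (g_fun \<beta> t lam) x = lam * g_fun \<beta> t lam x"
  proof (cases "x \<in> X")
    case False
    then show ?thesis
      by (simp add: transfer_fun_outside g_fun_eq gstep_def interval_def)
  next
    case True
    \<comment> \<open>With at most two preimages, the operator forms a finite combination of
      convergent series and acts term by term.\<close>
    have "transfer_fun \<beta> t (g_fun \<beta> t lam) x = (\<Sum>n. gcoeff n * transfer_fun \<beta> t (gstep n) x)"
    proof (cases "lex_le x (shift ?q)")
      case le: True
      have sm: "summable (\<lambda>n. gcoeff n * gstep n (case_nat a x))" if "a = 0 \<or> a = 1" for a
        using True le that by (intro summable_g_term) (auto simp: case_nat_in_beta_shift)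
      have "(\<Sum>n. gcoeff n * transfer_fun \<beta> t (gstep n) x) =
        (\<Sum>n. gcoeff n * gstep n (case_nat 0 x) + of_real (exp t) * (gcoeff n * gstep n (case_nat 1 x)))"
        using True le by (simp add: transfer_fun_eq algebra_simps)
      also have "\<dots> = (\<Sum>n. gcoeff n * gstep n (case_nat 0 x)) + of_real (exp t) * (\<Sum>n. gcoeff n * gstep n (case_nat 1 x))"
        using sm by (simp add: suminf_add[symmetric] suminf_mult summable_mult)
      finally show ?thesis using True le by (simp add: transfer_fun_eq g_fun_eq)
    qed (use True in \<open>simp add: transfer_fun_eq g_fun_eq\<close>)
    also have "\<dots> = (\<Sum>n. gcoeff n * of_nat (?q n) + lam * (gcoeff (Suc n) * gstep (Suc n) x))"
    proof (intro suminf_cong)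
      fix n
      \<comment> \<open>The weight turns \<open>H n\<close> into \<open>H (Suc n)\<close>; the
        factor \<open>lam\<close> compensates for the additional power in the denominator.\<close>
      have "gcoeff n * of_real (exp (t * ?q n)) = lam * gcoeff (Suc n)"
        using lam by (simp add: gcoeff_def H_def distrib_left exp_add)
      then show "gcoeff n * transfer_fun \<beta> t (gstep n) x =
        gcoeff n * of_nat (?q n) + lam * (gcoeff (Suc n) * gstep (Suc n) x)"
        using transfer_fun_indicator[OF True shift_funpow_in_beta_shift[OF qone_in_beta_shift], of t n]
        by (simp add: gstep_def shift_funpow distrib_left mult.assoc[symmetric])
    qed
    also have "\<dots> = (\<Sum>n. gcoeff n * of_nat (?q n)) + lam * (\<Sum>n. gcoeff (Suc n) * gstep (Suc n) x)"
    proof -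
      have "summable (\<lambda>n. gcoeff (Suc n) * gstep (Suc n) x)"
        using summable_g_term[OF True] by (simp add: summable_Suc_iff[of "\<lambda>n. gcoeff n * gstep n x"])
      then show ?thesis
        using summable_cq by (simp add: suminf_add[symmetric] suminf_mult summable_mult)
    qed
    \<comment> \<open>Here the zero of 1 - \<phi> enters. The summand of index \<open>n\<close> in
      \<open>phi\<close> has degree \<open>Suc n\<close>, which leaves one factor
      \<open>inverse lam\<close>.\<close>
    also have "(\<Sum>n. gcoeff n * of_nat (?q n)) = lam"
    proof -
      have "of_nat (?q n) * of_real (H n t ?q) * inverse lam ^ Suc n = gcoeff n * of_nat (?q n) * inverse lam" for n
        by (simp add: gcoeff_def field_simps)
      then have "phi \<beta> t (inverse lam) = (\<Sum>n. gcoeff n * of_nat (?q n)) * inverse lam"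
        unfolding phi_def by (simp only: suminf_mult2[OF summable_cq])
      then show ?thesis using assms lam by (simp add: field_simps)
    qed
    \<comment> \<open>The missing term of index 0 is the constant 1, since every point of the
      beta-shift is below \<open>qone \<beta>\<close>.\<close>
    also have "(\<Sum>n. gcoeff (Suc n) * gstep (Suc n) x) = g_fun \<beta> t lam x - 1"
      using suminf_split_head[OF summable_g_term[OF True]] True lex_le_qone[OF True]
      by (simp add: g_fun_eq gcoeff_def gstep_def H_def indicator_initial_interval)
    finally show ?thesis by (simp add: right_diff_distrib)
  qed
qed

text \<open>
  The limit \<open>S\<close> of the eigenfunction along the greedy expansions of numbers tending to 1. If \<open>p\<close>
  is the least period of the expansion of 1, then \<open>S = 1 + gcoeff p * S\<close>.
\<close>

lemma periodic_sum_nonzero: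
  "(\<Sum>k. gcoeff k * (if (shift ^^ k) (qone \<beta>) = qone \<beta> then 1 else 0)) \<noteq> 0" (is "suminf ?b \<noteq> 0")
proof (cases "\<exists>p>0. (shift ^^ p) (qone \<beta>) = qone \<beta>")
  case False
  \<comment> \<open>Without a period only the index 0 survives, and its coefficient is 1.\<close>
  then have "(shift ^^ k) (qone \<beta>) \<noteq> qone \<beta>" if "k \<notin> {0}" for k
    using that by (cases k) blast+
  then have "?b k = 0" if "k \<notin> {0}" for k using that by simp
  then have "suminf ?b = sum ?b {0}" by (intro suminf_finite) auto
  then show ?thesis by (simp add: gcoeff_def H_def)
next
  case True
  define p where "p = (LEAST p. 0 < p \<and> (shift ^^ p) (qone \<beta>) = qone \<beta>)"
  have p: "0 < p" "(shift ^^ p) (qone \<beta>) = qone \<beta>"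
    using LeastI_ex[of "\<lambda>p. 0 < p \<and> (shift ^^ p) (qone \<beta>) = qone \<beta>"] True unfolding p_def by auto
  have least: "(shift ^^ k) (qone \<beta>) \<noteq> qone \<beta>" if "0 < k" "k < p" for k
    using that not_less_Least unfolding p_def by blast
  have sm: "summable ?b"
    by (rule summable_comparison_test'[OF summable_norm_gcoeff, of 0]) simp
  have "?b (k + p) = gcoeff p * ?b k" for k
    using p by (simp add: gcoeff_add funpow_add)
  moreover have "sum ?b {..<p} = (\<Sum>k<p. if k = 0 then 1 else 0)"
    using least by (intro sum.cong) (auto simp: gcoeff_def H_def)
  then have "sum ?b {..<p} = 1" using p by simp
  ultimately have "suminf ?b = gcoeff p * suminf ?b + 1"
    using suminf_split_initial_segment[OF sm, of p] sm by (simp add: suminf_mult)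
  \<comment> \<open>The value 0 would turn this equation into 0 = 1.\<close>
  then show ?thesis by auto
qed

text \<open>Dominated convergence of the series gives a non-zero limit along
  \<open>digits y\<close>, so the function is non-zero there for all \<open>y\<close> in an interval
  ending at 1. Strict monotonicity makes these uncountably many distinct points.\<close>

lemma g_fun_not_null: "uncountable {x \<in> X. g_fun \<beta> t lam x \<noteq> 0}"
proof -
  let ?b = "\<lambda>k. gcoeff k * (if (shift ^^ k) (qone \<beta>) = qone \<beta> then 1 else 0)"
  have "((\<lambda>y. \<Sum>k. gcoeff k * gstep k (digits y)) \<longlongrightarrow> suminf ?b) (at_left 1)"
  proof (rule tannerys_theorem[THEN conjunct2, THEN conjunct2])
    show "((\<lambda>y. gcoeff k * gstep k (digits y)) \<longlongrightarrow> ?b k) (at_left 1)" for k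
      using digits_indicator_tendsto[of k] unfolding gstep_def
      by (intro tendsto_mult tendsto_const tendsto_eventually)
    show "\<forall>\<^sub>F (k, y) in at_top \<times>\<^sub>F at_left 1. norm (gcoeff k * gstep k (digits y)) \<le> norm (gcoeff k)"
      using norm_gstep_le by (intro always_eventually) (simp add: norm_mult mult_left_le)
  qed (use summable_norm_gcoeff in simp_all)
  then have "\<forall>\<^sub>F y in at_left 1. g_fun \<beta> t lam (digits y) \<noteq> 0"
    unfolding g_fun_eq using periodic_sum_nonzero by (rule tendsto_imp_eventually_ne)
  with eventually_unit_interval
  have "\<forall>\<^sub>F y in at_left 1. 0 < y \<and> y < 1 \<and> g_fun \<beta> t lam (digits y) \<noteq> 0"
    by eventually_elim simp
  then obtain y0 where y0: "y0 < 1"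
    "\<And>y. y0 < y \<Longrightarrow> y < 1 \<Longrightarrow> 0 < y \<and> g_fun \<beta> t lam (digits y) \<noteq> 0"
    unfolding eventually_at_left_field by blast
  have "inj_on digits {y0<..<1}"
  proof (rule linorder_inj_onI)
    fix y z assume "y < z" "y \<in> {y0<..<1}" "z \<in> {y0<..<1}"
    then have "less_fun (digits y) (digits z)" using y0(2)[of y] by (intro digits_strict_mono) auto
    then show "digits y \<noteq> digits z" using less_fun_irrefl by metis
  qed auto
  then have "uncountable (digits ` {y0<..<1})"
    using y0(1) by (simp add: countable_image_inj_eq uncountable_open_interval)
  moreover have "digits ` {y0<..<1} \<subseteq> {x \<in> X. g_fun \<beta> t lam x \<noteq> 0}"
    using y0(2) digits_in_beta_shift by (force simp: less_imp_le)
  ultimately show ?thesis using countable_subset by blast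
qed

end

end

theorem theorem3p6:
  fixes \<beta> t lt :: real and \<nu> :: "cfun set \<Rightarrow> complex" and lam :: complex
  assumes "1 < \<beta>" and "\<beta> \<le> 2"
    and "dual_eigenpair \<beta> t lt \<nu>"
    and "lam \<noteq> 0"
    and "1 - phi \<beta> t (inverse lam) = 0"
    and "inverse lt \<le> norm (inverse lam)"
    and "ereal (norm (inverse lam)) < inverse (growth_rate \<beta> t)"
  shows "(\<forall>x\<in>beta_shift \<beta>. summable (\<lambda>n. g_term \<beta> t lam n x)) \<and>
    cls \<beta> (g_fun \<beta> t lam) \<in> Fspace \<beta> \<and>
    cls \<beta> (g_fun \<beta> t lam) \<noteq> cls_zero \<beta> \<and>
    transfer_op \<beta> t (cls \<beta> (g_fun \<beta> t lam)) = cls_scale \<beta> lam (cls \<beta> (g_fun \<beta> t lam)) \<and>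
    is_eigenvalue \<beta> t lam"
proof -
  interpret beta_numeration \<beta> using assms by unfold_locales
  note smc = summable_coeff[OF assms(4,7)]
  let ?g = "g_fun \<beta> t lam"
  note BV = g_fun_BV[OF assms(4) smc] and F = g_fun_in_Fspace[OF assms(4) smc]
  have "\<forall>x\<in>beta_shift \<beta>. summable (\<lambda>n. g_term \<beta> t lam n x)"
    using summable_g_term[OF assms(4) smc] g_term_eq[OF assms(4) smc] by simp
  \<comment> \<open>Being in the zero class would confine the non-zero values to a countable
    set.\<close>
  moreover have nz: "cls \<beta> ?g \<noteq> cls_zero \<beta>"
  proof
    assume "cls \<beta> ?g = cls_zero \<beta>"
    then have "(\<lambda>_. 0, ?g) \<in> BV_rel \<beta>"
      using cls_self[OF BV] by (simp add: cls_zero_def mem_cls)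
    moreover have "{x \<in> X. 0 \<noteq> ?g x} = {x \<in> X. ?g x \<noteq> 0}" by auto
    ultimately show False using g_fun_not_null[OF assms(4) smc] by (simp add: BV_rel_iff)
  qed
  moreover have "transfer_op \<beta> t (cls \<beta> ?g) = cls_scale \<beta> lam (cls \<beta> ?g)"
    by (simp add: transfer_op_cls cls_scale_cls BV transfer_fun_g_fun[OF assms(4) smc assms(5)])
  ultimately show ?thesis unfolding is_eigenvalue_def using F by blast
qed

end
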